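(* Let $G(s)$ be a square transfer-function matrix that is real and strictly proper. (a) For any real $\sigma_2>\sigma_1$ and any $\omega\ge0$ for which both $I-\sigma_1G(j\omega)$ and $I-\sigma_2G(j\omega)$ are nonsingular (with $j\omega$ not a pole of $G$), $$\omega\in\Omega_{\rm PD}(\sigma_2)\ \Longrightarrow\ \omega\in\Omega_{\rm PD}(\sigma_1).$$ (b) For any $\sigma_2>\sigma_1\ge 0$, $$\tilde\Omega_{\rm PD}(\sigma_2)\subseteq\tilde\Omega_{\rm PD}(\sigma_1).$$
   Context: Transfer functions are (matrices of) rational functions of $s$; "real" means real coefficients. $M^H$ is the conjugate transpose, $M\succeq 0$ means Hermitian positive semidefinite, and $\rho_M(x)=x^HMx/(x^Hx)$ for $x\neq0$ is the Rayleigh quotient. For $\sigma\in\mathbb R$ let $H_\sigma(s)=(I-\sigma G(s))^{-1}G(s)$ wherever well-defined. The output-feedback positive-damping (OF-PD) frequency band is $$\Omega_{\rm PD}(\sigma)=\{\omega\ge0:\ j\omega\text{ is not a pole of }G,\ I-\sigma G(j\omega)\text{ is nonsingular},\ H_\sigma(j\omega)+H_\sigma^H(j\omega)\succeq0\}.$$ For $\sigma\ge0$ the Rayleigh-screened band is $$\tilde\Omega_{\rm PD}(\sigma)=\{\omega\ge0:\ j\omega\text{ is not a pole of }G,\ \Re(\rho_{G(j\omega)}(x))\ge\sigma|\rho_{G(j\omega)}(x)|^2\ \text{ for all }x\neq0\}.$$ *)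

theory Defs
  imports
    "HOL-Complex_Analysis.Complex_Analysis"
    "HOL-Computational_Algebra.Computational_Algebra"
    "HOL-Computational_Algebra.Field_as_Ring"
begin

type_synonym real_tf = "real poly fract"

text \<open>
  \<open>quot_of_fract\<close> is the representation in lowest terms with monic denominator, so the value is
  the usual one at removable singularities; only at a pole does \<open>z / 0 = 0\<close> come into play.
\<close>

definition tf_num :: "real_tf \<Rightarrow> real poly" where
  "tf_num g = fst (quot_of_fract g)"

definition tf_den :: "real_tf \<Rightarrow> real poly" where
  "tf_den g = snd (quot_of_fract g)"

definition tf_eval :: "real_tf \<Rightarrow> complex \<Rightarrow> complex" where
  "tf_eval g s = poly (map_poly of_real (tf_num g)) s / poly (map_poly of_real (tf_den g)) s"

text \<open>The zero function is \<open>0 / 1\<close> in lowest terms and has to be admitted separately.\<close>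

definition tf_strictly_proper :: "real_tf \<Rightarrow> bool" where
  "tf_strictly_proper g \<longleftrightarrow> g = 0 \<or> degree (tf_num g) < degree (tf_den g)"

definition tfm_eval :: "real_tf ^ 'm ^ 'n \<Rightarrow> complex \<Rightarrow> complex ^ 'm ^ 'n" where
  "tfm_eval G s = (\<chi> i k. tf_eval (G $ i $ k) s)"

definition tfm_strictly_proper :: "real_tf ^ 'm ^ 'n \<Rightarrow> bool" where
  "tfm_strictly_proper G \<longleftrightarrow> (\<forall>i k. tf_strictly_proper (G $ i $ k))"

definition tfm_is_pole :: "real_tf ^ 'm ^ 'n \<Rightarrow> complex \<Rightarrow> bool" where
  "tfm_is_pole G s \<longleftrightarrow> (\<exists>i k. is_pole (tf_eval (G $ i $ k)) s)"

lemma is_pole_tf_eval_iff: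
  "is_pole (tf_eval g) s \<longleftrightarrow> poly (map_poly of_real (tf_den g)) s = 0"
proof
  assume pole: "is_pole (tf_eval g) s"
  show "poly (map_poly of_real (tf_den g)) s = 0"
  proof (rule ccontr)
    assume "poly (map_poly of_real (tf_den g)) s \<noteq> 0"
    then have "isCont (tf_eval g) s"
      unfolding tf_eval_def by (intro continuous_intros) auto
    with pole show False
      using not_tendsto_and_filterlim_at_infinity[OF trivial_limit_at]
      unfolding is_pole_def isCont_def by blast
  qed
next
  let ?c = "map_poly complex_of_real"
  assume den: "poly (?c (tf_den g)) s = 0"
  have add: "?c (p + q) = ?c p + ?c q" and mult: "?c (p * q) = ?c p * ?c q" for p q
    by (simp_all add: poly_eq_iff coeff_map_poly coeff_mult)
  have "coprime (tf_num g) (tf_den g)"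
    by (simp add: tf_num_def tf_den_def coprime_quot_of_fract)
  then obtain a b where "a * tf_num g + b * tf_den g = 1"
    by (metis bezout_coefficients coprime_iff_gcd_eq_1 surj_pair)
  then have "poly (?c (a * tf_num g + b * tf_den g)) s = 1"
    by simp
  then have num: "poly (?c (tf_num g)) s \<noteq> 0"
    using den by (auto simp: add mult)
  have "tf_den g \<noteq> 0"
    by (simp add: tf_den_def)
  then have "?c (tf_den g) \<noteq> 0"
    by (simp add: map_poly_eq_0_iff)
  then have "finite {z. poly (?c (tf_den g)) z = 0}"
    by (rule poly_roots_finite)
  then have "\<not> s islimpt {z. poly (?c (tf_den g)) z = 0}"
    by (rule islimpt_finite)
  then have "eventually (\<lambda>z. poly (?c (tf_den g)) z \<noteq> 0) (at s)"
    by (simp add: islimpt_iff_eventually)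
  moreover have "isCont (poly (?c (tf_den g))) s"
    by (intro continuous_intros)
  ultimately have "filterlim (poly (?c (tf_den g))) (at 0) (at s)"
    using den by (auto simp: filterlim_at isCont_def)
  then show "is_pole (tf_eval g) s"
    unfolding tf_eval_def using num by (intro is_pole_divide) auto
qed

definition conj_transpose :: "complex ^ 'm ^ 'n \<Rightarrow> complex ^ 'n ^ 'm" where
  "conj_transpose M = (\<chi> i k. cnj (M $ k $ i))"

text \<open>
  \<open>cinner x y\<close> is $x^H y$; the library's \<open>x \<bullet> y\<close> on \<open>complex ^ 'n\<close> is only its real part.
\<close>

definition cinner :: "complex ^ 'n \<Rightarrow> complex ^ 'n \<Rightarrow> complex" where
  "cinner x y = (\<Sum>i\<in>UNIV. cnj (x $ i) * y $ i)"

definition hermitian :: "complex ^ 'n ^ 'n \<Rightarrow> bool" where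
  "hermitian M \<longleftrightarrow> conj_transpose M = M"

definition pos_semidef :: "complex ^ 'n ^ 'n \<Rightarrow> bool" where
  "pos_semidef M \<longleftrightarrow> hermitian M \<and> (\<forall>x. 0 \<le> Re (cinner x (M *v x)))"

definition rayleigh :: "complex ^ 'n ^ 'n \<Rightarrow> complex ^ 'n \<Rightarrow> complex" where
  "rayleigh M x = cinner x (M *v x) / cinner x x"

definition H_shift :: "real_tf ^ 'n ^ 'n \<Rightarrow> real \<Rightarrow> complex \<Rightarrow> complex ^ 'n ^ 'n" where
  "H_shift G \<sigma> s = matrix_inv (mat 1 - \<sigma> *\<^sub>R tfm_eval G s) ** tfm_eval G s"

definition Omega_PD :: "real_tf ^ 'n ^ 'n \<Rightarrow> real \<Rightarrow> real set" where
  "Omega_PD G \<sigma> = {\<omega>. 0 \<le> \<omega> \<and> \<not> tfm_is_pole G (\<i> * of_real \<omega>) \<and>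
     invertible (mat 1 - \<sigma> *\<^sub>R tfm_eval G (\<i> * of_real \<omega>)) \<and>
     pos_semidef (H_shift G \<sigma> (\<i> * of_real \<omega>) + conj_transpose (H_shift G \<sigma> (\<i> * of_real \<omega>)))}"

definition Omega_PD_screened :: "real_tf ^ 'n ^ 'n \<Rightarrow> real \<Rightarrow> real set" where
  "Omega_PD_screened G \<sigma> = {\<omega>. 0 \<le> \<omega> \<and> \<not> tfm_is_pole G (\<i> * of_real \<omega>) \<and>
     (\<forall>x. x \<noteq> 0 \<longrightarrow> Re (rayleigh (tfm_eval G (\<i> * of_real \<omega>)) x)
        \<ge> \<sigma> * (cmod (rayleigh (tfm_eval G (\<i> * of_real \<omega>)) x))\<^sup>2)}"

end

theory Submission
  imports Defs
begin

text \<open>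
  Write \<open>A = I - \<sigma> M\<close>, which commutes with \<open>M\<close>. Substituting \<open>x = A y\<close> in the quadratic form of
  \<open>H = A\<^sup>-\<^sup>1 M\<close> gives \<open>x\<^sup>H H x = (A y)\<^sup>H M y = y\<^sup>H M y - \<sigma> \<parallel>M y\<parallel>\<^sup>2\<close>. Hence \<open>H + H\<^sup>H\<close> is positive
  semidefinite iff \<open>\<sigma> \<parallel>M y\<parallel>\<^sup>2 \<le> Re (y\<^sup>H M y)\<close> for all \<open>y\<close>, a condition that only weakens as
  \<open>\<sigma>\<close> decreases.
\<close>

lemma cinner_diff_left: "cinner (x - y) z = cinner x z - cinner y z"
  by (simp add: cinner_def algebra_simps sum_subtractf)

lemma cinner_add_right: "cinner x (y + z) = cinner x y + cinner x z"
  by (simp add: cinner_def algebra_simps sum.distrib)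

lemma cinner_scaleR_left: "cinner (r *\<^sub>R x) y = r *\<^sub>R cinner x y"
  by (simp add: cinner_def scaleR_sum_right)

lemma cnj_cinner: "cnj (cinner x y) = cinner y x"
  by (simp add: cinner_def cnj_sum mult.commute)

lemma Re_cinner_self_nonneg: "0 \<le> Re (cinner x x)"
  by (simp add: cinner_def Re_sum sum_nonneg)

lemma cinner_conj_transpose: "cinner x (conj_transpose M *v y) = cinner (M *v x) y"
proof -
  have "cinner x (conj_transpose M *v y)
      = (\<Sum>i\<in>UNIV. \<Sum>j\<in>UNIV. cnj (x $ i) * (cnj (M $ j $ i) * y $ j))"
    by (simp add: cinner_def conj_transpose_def matrix_vector_mult_def sum_distrib_left)
  also have "\<dots> = (\<Sum>j\<in>UNIV. \<Sum>i\<in>UNIV. cnj (x $ i) * (cnj (M $ j $ i) * y $ j))"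
    by (rule sum.swap)
  also have "\<dots> = cinner (M *v x) y"
    by (simp add: cinner_def matrix_vector_mult_def sum_distrib_left cnj_sum mult_ac)
  finally show ?thesis .
qed

text \<open>The number x^H M^H x is the complex conjugate of x^H M x, so both contribute the same
  real part.\<close>

lemma Re_cinner_add_conj_transpose:
  "Re (cinner x ((M + conj_transpose M) *v x)) = 2 * Re (cinner x (M *v x))"
proof -
  have "Re (cinner (M *v x) x) = Re (cinner x (M *v x))"
    by (metis cnj_cinner cnj.sel(1))
  then show ?thesis
    by (simp add: matrix_vector_mult_add_rdistrib cinner_add_right cinner_conj_transpose)
qed

lemma hermitian_add_conj_transpose: "hermitian (M + conj_transpose M)"
  by (simp add: hermitian_def conj_transpose_def vec_eq_iff add.commute)

lemma scaleR_mult_vec: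
  fixes M :: "'a::real_algebra_1 ^ 'm ^ 'n"
  shows "(r *\<^sub>R M) *v x = r *\<^sub>R (M *v x)"
  by (simp add: matrix_vector_mult_def vec_eq_iff scaleR_sum_right)

lemma mult_scaleR_vec:
  fixes M :: "'a::real_algebra_1 ^ 'm ^ 'n"
  shows "M *v (r *\<^sub>R x) = r *\<^sub>R (M *v x)"
  by (simp add: matrix_vector_mult_def vec_eq_iff scaleR_sum_right)

lemma pos_semidef_shift_iff:
  fixes M :: "complex ^ 'n ^ 'n" and \<sigma> :: real
  defines "A \<equiv> mat 1 - \<sigma> *\<^sub>R M"
  defines "H \<equiv> matrix_inv A ** M"
  assumes inv: "invertible A"
  shows "pos_semidef (H + conj_transpose H) \<longleftrightarrow>
    (\<forall>y. \<sigma> * Re (cinner (M *v y) (M *v y)) \<le> Re (cinner y (M *v y)))"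
proof -
  have A: "A *v y = y - \<sigma> *\<^sub>R (M *v y)" for y
    by (simp add: A_def matrix_vector_mult_diff_rdistrib scaleR_mult_vec)
  have "A ** matrix_inv A = mat 1 \<and> matrix_inv A ** A = mat 1"
    using inv unfolding matrix_inv_def invertible_def by (rule someI_ex)
  then have right: "A ** matrix_inv A = mat 1" and left: "matrix_inv A ** A = mat 1"
    by simp_all
  \<comment> \<open>\<open>A\<close> is a polynomial in \<open>M\<close>, so the two commute; this
    lets \<open>matrix_inv A\<close> cancel in \<open>H *v (A *v y)\<close>.\<close>
  have "M *v (A *v y) = A *v (M *v y)" for y
    by (simp add: A matrix_vector_mult_diff_distrib mult_scaleR_vec)
  then have H: "H *v (A *v y) = M *v y" for y
    by (metis H_def left matrix_vector_mul_assoc matrix_vector_mul_lid)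
  \<comment> \<open>Since \<sigma> is real, it leaves the conjugate-linear first argument
    unchanged.\<close>
  have form: "Re (cinner (A *v y) (H *v (A *v y)))
      = Re (cinner y (M *v y)) - \<sigma> * Re (cinner (M *v y) (M *v y))" for y
    unfolding H by (simp add: A cinner_diff_left cinner_scaleR_left)
  \<comment> \<open>Surjectivity of \<open>A\<close>: the vectors \<open>A *v y\<close> exhaust the
    space, so testing the form on them loses nothing.\<close>
  have "x = A *v (matrix_inv A *v x)" for x
    by (simp add: matrix_vector_mul_assoc right)
  then have "(\<forall>x. 0 \<le> Re (cinner x (H *v x)))
      \<longleftrightarrow> (\<forall>y. 0 \<le> Re (cinner (A *v y) (H *v (A *v y))))"
    by metis
  then show ?thesis
    by (simp add: pos_semidef_def hermitian_add_conj_transpose Re_cinner_add_conj_transpose form)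
qed

text \<open>After \<open>pos_semidef_shift_iff\<close> is applied at both shifts, \<sigma> only
  multiplies the nonnegative number \<open>cinner (M *v y) (M *v y)\<close>, where \<open>M\<close>
  is the value of \<open>G\<close>.\<close>

lemma Omega_PD_antimono:
  assumes "\<sigma>\<^sub>1 \<le> \<sigma>\<^sub>2" and "\<omega> \<in> Omega_PD G \<sigma>\<^sub>2"
    and "invertible (mat 1 - \<sigma>\<^sub>1 *\<^sub>R tfm_eval G (\<i> * of_real \<omega>))"
  shows "\<omega> \<in> Omega_PD G \<sigma>\<^sub>1"
  using assms(2,3)
  by (auto simp: Omega_PD_def H_shift_def pos_semidef_shift_iff
      intro: order_trans[OF mult_right_mono[OF assms(1) Re_cinner_self_nonneg]])

text \<open>No inverse occurs in the screened condition: \<sigma> directly multiplies the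
  nonnegative squared modulus of the Rayleigh quotient, so a smaller \<sigma> asks for less.\<close>

lemma Omega_PD_screened_antimono:
  assumes "\<sigma>\<^sub>1 \<le> \<sigma>\<^sub>2"
  shows "Omega_PD_screened G \<sigma>\<^sub>2 \<subseteq> Omega_PD_screened G \<sigma>\<^sub>1"
  by (auto simp: Omega_PD_screened_def
      intro: order_trans[OF mult_right_mono[OF assms zero_le_power2]])

theorem corollary2:
  fixes G :: "real_tf ^ 'n ^ 'n"
  assumes "tfm_strictly_proper G"
  shows "(\<forall>\<sigma>\<^sub>1 \<sigma>\<^sub>2 \<omega>. \<sigma>\<^sub>1 < \<sigma>\<^sub>2 \<longrightarrow> 0 \<le> \<omega> \<longrightarrow> \<not> tfm_is_pole G (\<i> * of_real \<omega>) \<longrightarrow>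
             invertible (mat 1 - \<sigma>\<^sub>1 *\<^sub>R tfm_eval G (\<i> * of_real \<omega>)) \<longrightarrow>
             invertible (mat 1 - \<sigma>\<^sub>2 *\<^sub>R tfm_eval G (\<i> * of_real \<omega>)) \<longrightarrow>
             \<omega> \<in> Omega_PD G \<sigma>\<^sub>2 \<longrightarrow> \<omega> \<in> Omega_PD G \<sigma>\<^sub>1) \<and>
         (\<forall>\<sigma>\<^sub>1 \<sigma>\<^sub>2. 0 \<le> \<sigma>\<^sub>1 \<longrightarrow> \<sigma>\<^sub>1 < \<sigma>\<^sub>2 \<longrightarrow> Omega_PD_screened G \<sigma>\<^sub>2 \<subseteq> Omega_PD_screened G \<sigma>\<^sub>1)"
  by (auto intro: Omega_PD_antimono[OF less_imp_le]
      dest: subsetD[OF Omega_PD_screened_antimono[OF less_imp_le]])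

end
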